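(* Let $n\geq 4$ be an even integer and let $(a,b,c)$ be a triple of nonnegative integers with $a+b+c=n-1$. For $0\le k\le n$ put $$ \lambda_k=\binom{n}{k}\Bigg[(-1)^c\binom{n-k}{c}\sum_{\ell=\max(0,\,k-b)}^{\min(a,\,k)}(-1)^{\ell}\binom{k}{\ell}\;-\;(-1)^a\binom{n-k}{a}\sum_{\ell=\max(0,\,k-b)}^{\min(c,\,k)}(-1)^{\ell}\binom{k}{\ell}\Bigg], $$ where a sum whose lower limit exceeds its upper limit is $0$. Then $$ \sum_{k=0}^n \lambda_k B_kB_{n-k}=0 . $$
   Context: $B_k$ denotes the $k$-th Bernoulli number, defined by $\frac{t}{e^t-1}=\sum_{k\ge0}B_k\frac{t^k}{k!}$ (so $B_0=1$, $B_1=-\tfrac12$, and $B_k=0$ for odd $k\ge3$). Binomial coefficients $\binom{m}{r}$ with $0\le m<r$ are $0$. *)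

theory Defs
  imports "HOL-Computational_Algebra.Formal_Power_Series"
begin

definition bernoulli :: "nat \<Rightarrow> real" where
  "bernoulli k = fact k * fps_nth (fps_X / (fps_exp 1 - 1)) k"

text \<open>The quotient above is a genuine one although the denominator has no constant term,
  since numerator and denominator both have subdegree 1.\<close>

lemma bernoulli_egf:
  "Abs_fps (\<lambda>k. bernoulli k / fact k) * (fps_exp 1 - 1) = fps_X"
proof -
  have nth1: "fps_nth (fps_exp (1::real) - 1) 1 \<noteq> 0" and nth0: "fps_nth (fps_exp (1::real) - 1) 0 = 0"
    by simp_all
  then have "subdegree (fps_exp (1::real) - 1) = 1"
    by (intro subdegreeI) auto
  moreover have "fps_exp (1::real) - 1 \<noteq> 0"
    using nth1 by force
  ultimately have "(fps_exp (1::real) - 1) dvd fps_X"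
    by (subst fps_dvd_iff) (auto simp: fps_X_neq_zero)
  moreover have "Abs_fps (\<lambda>k. bernoulli k / fact k) = fps_X / (fps_exp 1 - 1)"
    by (simp add: fps_eq_iff bernoulli_def)
  ultimately show ?thesis
    by simp
qed

text \<open>Natural-number subtraction truncates, so the lower summation bound \<open>k - b\<close> is
  \<open>max(0, k - b)\<close>. The coefficient is meant for \<open>k \<le> n\<close>.\<close>

definition lam :: "nat \<Rightarrow> nat \<Rightarrow> nat \<Rightarrow> nat \<Rightarrow> nat \<Rightarrow> int" where
  "lam n a b c k = int (n choose k) *
     ((-1) ^ c * int ((n - k) choose c) * (\<Sum>l = k - b..min a k. (-1) ^ l * int (k choose l))
      - (-1) ^ a * int ((n - k) choose a) * (\<Sum>l = k - b..min c k. (-1) ^ l * int (k choose l)))"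

end

theory Submission
  imports Defs "HOL-Computational_Algebra.Polynomial"
begin

text \<open>Put $y = 1$ in the generating function $\sum x^a y^b z^c$ of the sums over all triples
  $a + b + c = n - 1$. With $h(t) = \frac t2 \coth \frac t2$, whose Taylor coefficients are
  $B_k/k!$ except at $k = 1$ (harmless, as $B_1 B_{n-1} = 0$), and $u = 1 - x$, $v = x - z$, $w = z - 1$, it becomes up to the factor
  $-n!/(uw)$ the coefficient of $t^n$ in $w\,h(ut)h(vt) + u\,h(vt)h(wt) + v\,h(wt)h(ut)$. Since
  $u + v + w = 0$, the addition theorem of the hyperbolic cotangent shows that this series
  equals $-uvw\,t^2/4$.\<close>

section \<open>The even part of the Bernoulli generating function\<close>

definition bernoulli_fps :: "real \<Rightarrow> real fps" where
  "bernoulli_fps u = Abs_fps (\<lambda>k. bernoulli k / fact k * u ^ k)"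

text \<open>This is \<open>bernoulli_egf\<close> with t replaced by ut: the substitution multiplies
  the n-th coefficient of the product by \<open>u ^ n\<close>.\<close>

lemma bernoulli_fps_mult: "bernoulli_fps u * (fps_exp u - 1) = fps_const u * fps_X"
proof (rule fps_ext)
  fix n
  have "fps_nth (bernoulli_fps u * (fps_exp u - 1)) n
      = u ^ n * fps_nth (Abs_fps (\<lambda>k. bernoulli k / fact k) * (fps_exp 1 - 1)) n"
    unfolding fps_mult_nth sum_distrib_left
  proof (rule sum.cong[OF refl])
    fix i assume "i \<in> {0..n}"
    then have "u ^ n = u ^ i * u ^ (n - i)"
      by (simp flip: power_add)
    then show "fps_nth (bernoulli_fps u) i * fps_nth (fps_exp u - 1) (n - i) =
        u ^ n * (fps_nth (Abs_fps (\<lambda>k. bernoulli k / fact k)) i * fps_nth (fps_exp 1 - 1) (n - i))"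
      by (simp add: bernoulli_fps_def algebra_simps)
  qed
  then show "fps_nth (bernoulli_fps u * (fps_exp u - 1)) n = fps_nth (fps_const u * fps_X) n"
    by (simp add: bernoulli_egf fps_X_def)
qed

lemma fps_exp_neq_1: "u \<noteq> 0 \<Longrightarrow> fps_exp u - 1 \<noteq> (0 :: real fps)"
  by (auto simp: fps_eq_iff intro!: exI[of _ 1])

text \<open>Coefficientwise form of b(-t) = b(t) + t for b(t) = t/(e^t - 1). It yields both the
  value at index 1 and the vanishing at the other odd indices.\<close>

lemma bernoulli_reflect: "((-1) ^ k - 1) * bernoulli k = (if k = 1 then 1 else 0)"
proof -
  let ?E = "fps_exp (1::real)"
  have inv: "?E * fps_exp (-1) = 1"
    by (simp flip: fps_exp_add_mult)
  have minus: "bernoulli_fps (-1) * (fps_exp (-1) - 1) = - fps_X"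
    unfolding bernoulli_fps_mult by (simp add: fps_eq_iff)
  \<comment> \<open>Multiplying e^(-t) - 1 by e^t gives 1 - e^t, so both sides acquire the common
    factor \<open>?E - 1\<close>, which can be cancelled.\<close>
  have "bernoulli_fps (-1) * (?E - 1) = - (?E * (bernoulli_fps (-1) * (fps_exp (-1) - 1)))"
    using inv by (simp add: algebra_simps)
  also have "\<dots> = fps_X * ?E"
    using minus by simp
  also have "\<dots> = (bernoulli_fps 1 + fps_X) * (?E - 1)"
    using bernoulli_fps_mult[of 1] by (simp add: algebra_simps)
  finally have "bernoulli_fps (-1) = bernoulli_fps 1 + fps_X"
    using fps_exp_neq_1[of 1] by simp
  then have "fps_nth (bernoulli_fps (-1)) k = fps_nth (bernoulli_fps 1 + fps_X) k"
    by simp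
  then show ?thesis
    by (auto simp: bernoulli_fps_def field_simps split: if_splits)
qed

lemma bernoulli_1: "bernoulli 1 = -1/2"
  using bernoulli_reflect[of 1] by simp

lemma bernoulli_odd: "odd k \<Longrightarrow> k \<noteq> 1 \<Longrightarrow> bernoulli k = 0"
  using bernoulli_reflect[of k] by simp

text \<open>The series of (ut/2) coth(ut/2): adding ut/2 to ut/(e^(ut) - 1) removes the linear term
  and leaves an even function.\<close>

definition half_coth_fps :: "real \<Rightarrow> real fps" where
  "half_coth_fps u = bernoulli_fps u + fps_const (u / 2) * fps_X"

lemma half_coth_fps_nth:
  "fps_nth (half_coth_fps u) k = (if k = 1 then 0 else bernoulli k / fact k * u ^ k)"
  by (auto simp: half_coth_fps_def bernoulli_fps_def bernoulli_1[simplified] fps_X_def)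

lemma half_coth_fps_minus: "half_coth_fps (- u) = half_coth_fps u"
proof (rule fps_ext)
  fix k
  show "fps_nth (half_coth_fps (- u)) k = fps_nth (half_coth_fps u) k"
    by (cases "even k") (auto simp: half_coth_fps_nth bernoulli_odd)
qed

text \<open>The formula coth s = (e^(2s) + 1)/(e^(2s) - 1) at s = ut/2, with the denominator
  cleared.\<close>

lemma half_coth_fps_mult:
  "half_coth_fps u * (fps_exp u - 1) = fps_const (u / 2) * fps_X * (fps_exp u + 1)"
proof -
  have "fps_const u = 2 * fps_const (u / 2)"
    by (simp add: numeral_fps_const)
  then show ?thesis
    using bernoulli_fps_mult[of u] by (simp add: half_coth_fps_def algebra_simps)
qed

text \<open>Equivalent to coth p coth q + coth q coth r + coth r coth p = -1 for p + q + r = 0.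
  Multiplying by all three denominators reduces it to a polynomial identity in the exponentials;
  these denominators are nonzero because \<open>u\<close>, \<open>v\<close>, \<open>w\<close> are,
  so they cancel afterwards.\<close>

lemma half_coth_fps_addition:
  assumes "u + v + w = 0" "u \<noteq> 0" "v \<noteq> 0" "w \<noteq> 0"
  shows "fps_const w * (half_coth_fps u * half_coth_fps v)
       + fps_const u * (half_coth_fps v * half_coth_fps w)
       + fps_const v * (half_coth_fps w * half_coth_fps u) = fps_const (- u * v * w / 4) * fps_X ^ 2"
proof -
  define a b c where "a = fps_exp u" and "b = fps_exp v" and "c = fps_exp w"
  define p q r where "p = half_coth_fps u" and "q = half_coth_fps v" and "r = half_coth_fps w"
  define u' v' w' where "u' = fps_const (u / 2)" and "v' = fps_const (v / 2)" and "w' = fps_const (w / 2)"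
  let ?X = "fps_X :: real fps"
  have abc: "a * b * c = 1"
    using assms(1) by (simp add: a_def b_def c_def flip: fps_exp_add_mult)
  have p: "p * (a - 1) = u' * ?X * (a + 1)" and q: "q * (b - 1) = v' * ?X * (b + 1)"
    and r: "r * (c - 1) = w' * ?X * (c + 1)"
    by (simp_all add: a_def b_def c_def p_def q_def r_def u'_def v'_def w'_def half_coth_fps_mult)
  have double: "fps_const u = 2 * u'" "fps_const v = 2 * v'" "fps_const w = 2 * w'"
    by (simp_all add: u'_def v'_def w'_def numeral_fps_const)
  have "(2 * w' * (p * q) + 2 * u' * (q * r) + 2 * v' * (r * p)) * ((a - 1) * (b - 1) * (c - 1))
     = 2 * w' * (p * (a - 1)) * (q * (b - 1)) * (c - 1)
     + 2 * u' * (q * (b - 1)) * (r * (c - 1)) * (a - 1)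
     + 2 * v' * (r * (c - 1)) * (p * (a - 1)) * (b - 1)"
    by (simp add: algebra_simps)
  also have "\<dots> = 2 * u' * v' * w' * ?X ^ 2 *
     ((a + 1) * (b + 1) * (c - 1) + (b + 1) * (c + 1) * (a - 1) + (c + 1) * (a + 1) * (b - 1))"
    unfolding p q r by (simp add: algebra_simps power2_eq_square)
  \<comment> \<open>The identity isolates \<open>a * b * c - 1\<close>, through which the condition
    \<open>u + v + w = 0\<close> enters.\<close>
  also have "(a + 1) * (b + 1) * (c - 1) + (b + 1) * (c + 1) * (a - 1) + (c + 1) * (a + 1) * (b - 1)
     = 4 * (a * b * c - 1) - (a - 1) * (b - 1) * (c - 1)"
    by (simp add: algebra_simps)
  also have "\<dots> = - ((a - 1) * (b - 1) * (c - 1))"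
    by (simp add: abc)
  finally have "(2 * w' * (p * q) + 2 * u' * (q * r) + 2 * v' * (r * p)) * ((a - 1) * (b - 1) * (c - 1))
     = (- (2 * u' * v' * w') * ?X ^ 2) * ((a - 1) * (b - 1) * (c - 1))"
    by simp
  moreover have "(a - 1) * (b - 1) * (c - 1) \<noteq> 0"
    using assms fps_exp_neq_1 by (simp add: a_def b_def c_def)
  ultimately have "2 * w' * (p * q) + 2 * u' * (q * r) + 2 * v' * (r * p)
     = - (2 * u' * v' * w') * ?X ^ 2"
    by (metis mult_right_cancel)
  moreover have "- (2 * u' * v' * w') = fps_const (- u * v * w / 4)"
    by (simp add: u'_def v'_def w'_def numeral_fps_const)
  ultimately show ?thesis
    unfolding double p_def q_def r_def by simp
qed

section \<open>The homogeneous quadratic form\<close>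

definition bernoulli_form :: "nat \<Rightarrow> real \<Rightarrow> real \<Rightarrow> real" where
  "bernoulli_form n u v =
     (\<Sum>k\<le>n. real (n choose k) * bernoulli k * bernoulli (n - k) * u ^ k * v ^ (n - k))"

text \<open>A binomial convolution is a product of exponential generating functions. Passing to the
  even parts changes only the factors of index 1, and these occur in terms that vanish.\<close>

lemma bernoulli_form_conv_fps:
  assumes "even n" "n \<ge> 4"
  shows "bernoulli_form n u v = fact n * fps_nth (half_coth_fps u * half_coth_fps v) n"
  unfolding bernoulli_form_def fps_mult_nth sum_distrib_left atMost_atLeast0
proof (rule sum.cong[OF refl])
  fix k assume k: "k \<in> {0..n}"
  \<comment> \<open>If one index is 1, the other is \<open>n - 1\<close>, which is odd and at least
    3.\<close>
  have "bernoulli k * bernoulli (n - k) = 0" if "k = 1 \<or> n - k = 1"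
  proof -
    from that k assms have "odd (n - k) \<and> n - k \<noteq> 1 \<or> odd k \<and> k \<noteq> 1"
      by auto presburger+
    then show ?thesis
      using bernoulli_odd by auto
  qed
  moreover have "real (n choose k) = fact n / (fact k * fact (n - k))"
    using k by (simp add: binomial_fact)
  ultimately show "real (n choose k) * bernoulli k * bernoulli (n - k) * u ^ k * v ^ (n - k) =
      fact n * (fps_nth (half_coth_fps u) k * fps_nth (half_coth_fps v) (n - k))"
    by (auto simp: half_coth_fps_nth)
qed

lemma bernoulli_form_commute: "even n \<Longrightarrow> n \<ge> 4 \<Longrightarrow> bernoulli_form n u v = bernoulli_form n v u"
  by (simp add: bernoulli_form_conv_fps mult.commute)

lemma bernoulli_form_minus: "even n \<Longrightarrow> n \<ge> 4 \<Longrightarrow> bernoulli_form n u (- v) = bernoulli_form n u v"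
  by (simp add: bernoulli_form_conv_fps half_coth_fps_minus)

text \<open>The right-hand side of the addition theorem is concentrated in degree 2, hence
  contributes nothing in degree \<open>n\<close>.\<close>

lemma bernoulli_form_cyclic:
  assumes "even n" "n \<ge> 4" "u + v + w = 0" "u \<noteq> 0" "v \<noteq> 0" "w \<noteq> 0"
  shows "w * bernoulli_form n u v + u * bernoulli_form n v w + v * bernoulli_form n w u = 0"
proof -
  have "w * bernoulli_form n u v + u * bernoulli_form n v w + v * bernoulli_form n w u
     = fact n * fps_nth (fps_const w * (half_coth_fps u * half_coth_fps v)
       + fps_const u * (half_coth_fps v * half_coth_fps w)
       + fps_const v * (half_coth_fps w * half_coth_fps u)) n"
    using assms(1,2) by (simp add: bernoulli_form_conv_fps algebra_simps)
  also have "\<dots> = 0"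
    using assms(2) by (subst half_coth_fps_addition[OF assms(3-6)]) (simp add: fps_X_power_nth)
  finally show ?thesis .
qed

section \<open>The generating polynomial\<close>

text \<open>The contribution of the first product in the bracket of \<open>lam\<close>. Since b is
  written as \<open>n - 1 - a - c\<close>, which is symmetric in \<open>a\<close> and
  \<open>c\<close>, the second product contributes \<open>lam_half n c a\<close>.\<close>

definition lam_half :: "nat \<Rightarrow> nat \<Rightarrow> nat \<Rightarrow> real" where
  "lam_half n a c = (\<Sum>k\<le>n. \<Sum>l = k - (n - 1 - a - c)..min a k.
     (-1) ^ (c + l) * real (n choose k) * real ((n - k) choose c) * real (k choose l)
       * bernoulli k * bernoulli (n - k))"

lemma sum_lam_eq:
  assumes "a + b + c = n - 1"
  shows "(\<Sum>k = 0..n. of_int (lam n a b c k) * bernoulli k * bernoulli (n - k))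
     = lam_half n a c - lam_half n c a"
proof -
  have "n - 1 - a - c = b" "n - 1 - c - a = b"
    using assms by auto
  then show ?thesis
    by (simp add: lam_half_def lam_def atMost_atLeast0 sum_distrib_left sum_distrib_right
        power_add algebra_simps flip: sum_subtractf)
qed

text \<open>Substituting a = l + p decouples the sums: the lower bound on l becomes p < n - k - c,
  and the now free sum over l is the binomial expansion of \<open>(1 - x) ^ k\<close>.\<close>

lemma sum_lam_half:
  assumes "n > 0"
  shows "(\<Sum>a<n. \<Sum>c<n - a. lam_half n a c * x ^ a * z ^ c)
     = (\<Sum>k\<le>n. real (n choose k) * bernoulli k * bernoulli (n - k) * (1 - x) ^ k *
         (\<Sum>c<n - k. real ((n - k) choose c) * (- z) ^ c * (\<Sum>p<n - k - c. x ^ p)))"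
proof -
  let ?f = "\<lambda>k i c p. real (n choose k) * bernoulli k * bernoulli (n - k)
     * real (k choose i) * (- x) ^ i * real ((n - k) choose c) * (- z) ^ c * x ^ p"
  let ?g = "\<lambda>a c k l. (-1) ^ (c + l) * real (n choose k) * real ((n - k) choose c)
     * real (k choose l) * bernoulli k * bernoulli (n - k) * x ^ a * z ^ c"
  have power_split: "x ^ l * (x ^ (a - l) * y) = x ^ a * y" if "l \<le> a" for a l y
    using that by (simp flip: mult.assoc power_add)
  have "(\<Sum>a<n. \<Sum>c<n - a. lam_half n a c * x ^ a * z ^ c)
     = (\<Sum>a<n. \<Sum>c<n - a. \<Sum>k\<le>n. \<Sum>l = k - (n - 1 - a - c)..min a k. ?g a c k l)"
    by (simp add: lam_half_def sum_distrib_right)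
  also have "\<dots> = (\<Sum>(a, c, k, l) \<in> (SIGMA a:{..<n}. SIGMA c:{..<n - a}. SIGMA k:{..n}.
      {k - (n - 1 - a - c)..min a k}). ?g a c k l)"
    by (simp add: sum.Sigma del: diff_diff_left Nat.diff_diff_right)
  also have "\<dots> = (\<Sum>(k, i, c, p) \<in> (SIGMA k:{..n}. SIGMA i:{..k}. SIGMA c:{..<n - k}.
      {..<n - k - c}). ?f k i c p)"
    \<comment> \<open>The new variables are i = l and p = a - l.\<close>
    by (rule sum.reindex_bij_witness[of _ "\<lambda>(k, i, c, p). (i + p, c, k, i)"
          "\<lambda>(a, c, k, l). (k, l, c, a - l)"])
      (auto simp: power_add power_minus[of x] power_minus[of z] algebra_simps power_split)
  also have "\<dots> = (\<Sum>k\<le>n. \<Sum>i\<le>k. \<Sum>c<n - k. \<Sum>p<n - k - c. ?f k i c p)"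
    by (simp add: sum.Sigma)
  also have "\<dots> = (\<Sum>k\<le>n. real (n choose k) * bernoulli k * bernoulli (n - k)
      * (\<Sum>i\<le>k. real (k choose i) * (- x) ^ i)
      * (\<Sum>c<n - k. real ((n - k) choose c) * (- z) ^ c * (\<Sum>p<n - k - c. x ^ p)))"
    unfolding mult.assoc sum_product by (simp add: sum_distrib_left)
  also have "\<dots> = (\<Sum>k\<le>n. real (n choose k) * bernoulli k * bernoulli (n - k) * (1 - x) ^ k
      * (\<Sum>c<n - k. real ((n - k) choose c) * (- z) ^ c * (\<Sum>p<n - k - c. x ^ p)))"
  proof -
    have "(\<Sum>i\<le>k. real (k choose i) * (- x) ^ i) = (1 - x) ^ k" for k
      using binomial_ring[of "- x" 1 k] by simp
    then show ?thesis by simp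
  qed
  finally show ?thesis .
qed

text \<open>The factor \<open>x - 1\<close> telescopes each geometric sum to
  \<open>x ^ (m - c) - 1\<close>, leaving two binomial expansions.\<close>

lemma sum_binomial_geometric:
  fixes x z :: real
  shows "(x - 1) * (\<Sum>c<m. real (m choose c) * (- z) ^ c * (\<Sum>p<m - c. x ^ p))
     = (x - z) ^ m - (1 - z) ^ m"
proof -
  have "(x - 1) * (\<Sum>c<m. real (m choose c) * (- z) ^ c * (\<Sum>p<m - c. x ^ p))
     = (\<Sum>c<m. real (m choose c) * (- z) ^ c * (x ^ (m - c) - 1))"
    by (simp add: sum_distrib_left power_diff_1_eq algebra_simps)
  \<comment> \<open>The added term c = m is zero, since \<open>x ^ 0 - 1 = 0\<close>.\<close>
  also have "\<dots> = (\<Sum>c\<le>m. real (m choose c) * (- z) ^ c * (x ^ (m - c) - 1))"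
    by (simp flip: lessThan_Suc_atMost)
  also have "\<dots> = (- z + x) ^ m - (- z + 1) ^ m"
    unfolding binomial_ring by (simp add: sum_subtractf algebra_simps)
  finally show ?thesis by simp
qed

lemma sum_lam_half_form:
  assumes "n > 0"
  shows "(x - 1) * (\<Sum>a<n. \<Sum>c<n - a. lam_half n a c * x ^ a * z ^ c)
     = bernoulli_form n (1 - x) (x - z) - bernoulli_form n (1 - x) (1 - z)"
proof -
  have "(x - 1) * (\<Sum>a<n. \<Sum>c<n - a. lam_half n a c * x ^ a * z ^ c)
     = (\<Sum>k\<le>n. real (n choose k) * bernoulli k * bernoulli (n - k) * (1 - x) ^ k *
         ((x - 1) * (\<Sum>c<n - k. real ((n - k) choose c) * (- z) ^ c * (\<Sum>p<n - k - c. x ^ p))))"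
    unfolding sum_lam_half[OF assms] by (simp add: sum_distrib_left mult_ac)
  then show ?thesis
    unfolding sum_binomial_geometric
    by (simp add: bernoulli_form_def right_diff_distrib sum_subtractf)
qed

text \<open>Both sides have closed forms in three values of the quadratic form, and the cyclic
  relation among these values forces equality. The excluded points are those where \<open>u\<close>,
  \<open>v\<close> or \<open>w\<close> vanishes.\<close>

lemma sum_lam_half_symmetric:
  assumes "even n" "n \<ge> 4" "x \<noteq> 1" "z \<noteq> 1" "x \<noteq> z"
  shows "(\<Sum>a<n. \<Sum>c<n - a. lam_half n a c * x ^ a * z ^ c)
     = (\<Sum>a<n. \<Sum>c<n - a. lam_half n a c * z ^ a * x ^ c)" (is "?P = ?Q")
proof -
  define u v w where "u = 1 - x" and "v = x - z" and "w = z - 1"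
  let ?B = "bernoulli_form n"
  note even = bernoulli_form_minus[OF assms(1,2)] and comm = bernoulli_form_commute[OF assms(1,2)]
  have neg: "x - 1 = - u" "1 - z = - w" "z - x = - v"
    by (simp_all add: u_def v_def w_def)
  have P: "- u * ?P = ?B u v - ?B w u"
    using sum_lam_half_form[of n x z] assms(2) neg even comm
    by (simp add: u_def[symmetric] v_def[symmetric])
  have "?B (- w) (- v) = ?B v w" "?B (- w) u = ?B w u"
    using even comm by metis+
  then have Q: "w * ?Q = ?B v w - ?B w u"
    using sum_lam_half_form[of n z x] assms(2) neg
    by (simp add: u_def[symmetric] w_def[symmetric])
  have "w * ?B u v + u * ?B v w + v * ?B w u = 0"
    using bernoulli_form_cyclic[OF assms(1,2), of u v w] assms(3-5)
    by (simp add: u_def v_def w_def)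
  \<comment> \<open>The left-hand side is w(-u P) + u(w Q) = uw(Q - P) for P = \<open>?P\<close> and
    Q = \<open>?Q\<close>.\<close>
  moreover have "w * (?B u v - ?B w u) + u * (?B v w - ?B w u)
     = w * ?B u v + u * ?B v w + v * ?B w u - (u + v + w) * ?B w u"
    by (simp add: algebra_simps)
  moreover have "u + v + w = 0"
    by (simp add: u_def v_def w_def)
  ultimately have "w * (?B u v - ?B w u) + u * (?B v w - ?B w u) = 0"
    by simp
  then have "u * w * (?Q - ?P) = 0"
    unfolding P[symmetric] Q[symmetric] by (simp add: algebra_simps)
  then show ?thesis
    using assms(3,4) by (simp add: u_def w_def)
qed

section \<open>Comparison of coefficients\<close>

text \<open>The complement of a finite set of reals is infinite, so the polynomial has infinitely
  many roots. Allowing exceptional points \<open>S\<close> accommodates the excluded values of x and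
  z.\<close>

lemma polynomial_coeffs_zero:
  fixes f :: "nat \<Rightarrow> real"
  assumes "finite S" "\<And>x. x \<notin> S \<Longrightarrow> (\<Sum>i<n. f i * x ^ i) = 0" "i < n"
  shows "f i = 0"
proof -
  define p where "p = (\<Sum>i<n. monom (f i) i)"
  have poly_p: "poly p x = (\<Sum>i<n. f i * x ^ i)" for x
    by (simp add: p_def poly_sum poly_monom)
  have "- S \<subseteq> {x. poly p x = 0}"
    using assms(2) by (auto simp: poly_p)
  moreover have "infinite (- S)"
    using assms(1) by (simp add: infinite_UNIV_char_0 finite_compl)
  ultimately have "p = 0"
    using poly_roots_finite[of p] finite_subset by blast
  moreover have "coeff p i = f i"
    using assms(3) by (simp add: p_def coeff_sum)
  ultimately show ?thesis by simp
qed

theorem theorem1: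
  fixes n a b c :: nat
  assumes "n \<ge> 4" and "even n" and "a + b + c = n - 1"
  shows "(\<Sum>k = 0..n. of_int (lam n a b c k) * bernoulli k * bernoulli (n - k)) = 0"
proof -
  \<comment> \<open>Extension by zero from the triangle a + c < n to a square makes the ranges of
    the two indices independent, so the polynomial can be treated one variable at a time.\<close>
  define d where "d a c = (if a + c < n then lam_half n a c - lam_half n c a else 0)" for a c
  have triangle: "(\<Sum>c<n. if a + c < n then g c else 0) = (\<Sum>c<n - a. g c)"
    for a and g :: "nat \<Rightarrow> real"
    by (rule sum.mono_neutral_cong_right) auto
  have vanish: "(\<Sum>c<n. (\<Sum>a<n. d a c * x ^ a) * z ^ c) = 0"
    if "x \<noteq> 1" "z \<notin> {1, x}" for x z
  proof -
    let ?t = "\<lambda>a c y y'. if a + c < n then lam_half n a c * y ^ a * y' ^ c else 0"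
    have "(\<Sum>c<n. (\<Sum>a<n. d a c * x ^ a) * z ^ c)
       = (\<Sum>c<n. \<Sum>a<n. ?t a c x z) - (\<Sum>c<n. \<Sum>a<n. ?t c a z x)"
      unfolding sum_subtractf[symmetric] sum_distrib_right
      by (intro sum.cong refl) (auto simp: d_def algebra_simps)
    \<comment> \<open>The swap puts the exponent of the first variable outermost, as it already is
      in the subtracted sum.\<close>
    also have "(\<Sum>c<n. \<Sum>a<n. ?t a c x z) = (\<Sum>a<n. \<Sum>c<n. ?t a c x z)"
      by (rule sum.swap)
    also have "\<dots> - (\<Sum>c<n. \<Sum>a<n. ?t c a z x) = 0"
      unfolding triangle using sum_lam_half_symmetric[OF assms(2,1), of x z] that by auto
    finally show ?thesis .
  qed
  \<comment> \<open>First x is fixed and the coefficients in z are compared, with z = 1 and z = x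
    excluded; then the coefficients in x are compared, with x = 1 excluded.\<close>
  have "(\<Sum>a<n. d a c * x ^ a) = 0" if "x \<notin> {1}" for x
    by (rule polynomial_coeffs_zero[of "{1, x}" "\<lambda>c. \<Sum>a<n. d a c * x ^ a" n])
      (use vanish that assms in auto)
  then have "d a c = 0"
    by (rule polynomial_coeffs_zero[of "{1}" "\<lambda>a. d a c" n, rotated]) (use assms in auto)
  moreover have "a + c < n"
    using assms by auto
  ultimately show ?thesis
    unfolding sum_lam_eq[OF assms(3)] by (simp add: d_def)
qed

end
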